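(* For every integer $n \equiv 3 \pmod 6$ with $n \geq 9$, there exists an edge-maximal doubly Eulerian graph of order $n$; that is, there exists a doubly Eulerian graph of order $n$ in which every vertex has degree $n-3$.
   Context: All graphs are finite, simple (no loops or multiple edges) and connected. A graph is Eulerian if it has a closed trail traversing every edge exactly once (an Eulerian circuit). Let $G$ be Eulerian with $m$ edges and $u$ a vertex. Two Eulerian circuits $u,v_1,\ldots,v_{m-1},u$ and $u,w_1,\ldots,w_{m-1},u$ starting and ending at $u$ are avoiding if for every $1\le i\le m-1$, $v_i\neq w_i$ and $v_i$ is not adjacent to $w_i$. $G$ is doubly Eulerian if for every vertex $u$ there is a pair of avoiding Eulerian circuits starting and ending at $u$. A doubly Eulerian graph of odd order $n$ is called edge-maximal if it attains the largest possible number of edges, namely if it is regular of degree $n-3$ (no doubly Eulerian graph of odd order $n$ has a vertex of degree $n-1$, and degrees are even). *)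

theory Defs
  imports "Graph_Theory.Graph_Theory"
begin

text \<open>
  Finite simple graphs are those of the locale \<^locale>\<open>pair_graph\<close>: finite, loop-free, symmetric
  digraphs, in which an undirected edge is represented by its two opposite arcs.  Since the
  library's trails would allow both of these arcs to be used, trails are stated below in terms of
  the undirected edges.
\<close>

definition uedge :: "'a \<times> 'a \<Rightarrow> 'a set" where
  "uedge e = {fst e, snd e}"

definition uedges :: "'a pair_pre_digraph \<Rightarrow> 'a set set" where
  "uedges G = uedge ` parcs G"

text \<open>A circuit is given by its full vertex sequence, with the start vertex repeated at the end;
  for a graph with \<open>m\<close> edges this list has length \<open>m + 1\<close>.\<close>

definition eulerian_circuit :: "'a pair_pre_digraph \<Rightarrow> 'a \<Rightarrow> 'a list \<Rightarrow> bool" where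
  "eulerian_circuit G u p \<longleftrightarrow>
     vwalk p (with_proj G) \<and> hd p = u \<and> last p = u \<and>
     distinct (map uedge (vwalk_arcs p)) \<and>
     set (map uedge (vwalk_arcs p)) = uedges G"

definition eulerian :: "'a pair_pre_digraph \<Rightarrow> bool" where
  "eulerian G \<longleftrightarrow>
     pair_graph G \<and> connected (with_proj G) \<and> (\<exists>u p. eulerian_circuit G u p)"

definition avoiding_circuits ::
    "'a pair_pre_digraph \<Rightarrow> 'a \<Rightarrow> 'a list \<Rightarrow> 'a list \<Rightarrow> bool" where
  "avoiding_circuits G u p q \<longleftrightarrow>
     eulerian_circuit G u p \<and> eulerian_circuit G u q \<and>
     (\<forall>i. 1 \<le> i \<and> i < card (uedges G) \<longrightarrow> p ! i \<noteq> q ! i \<and> (p ! i, q ! i) \<notin> parcs G)"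

definition doubly_eulerian :: "'a pair_pre_digraph \<Rightarrow> bool" where
  "doubly_eulerian G \<longleftrightarrow>
     eulerian G \<and> (\<forall>u \<in> pverts G. \<exists>p q. avoiding_circuits G u p q)"

text \<open>The competitors \<open>H\<close> live on the same vertex type as \<open>G\<close>; when that type is infinite, they
  comprise all finite graphs of the same order up to isomorphism.\<close>

definition edge_maximal :: "'a pair_pre_digraph \<Rightarrow> bool" where
  "edge_maximal G \<longleftrightarrow>
     doubly_eulerian G \<and> odd (card (pverts G)) \<and>
     (\<forall>H :: 'a pair_pre_digraph.
        doubly_eulerian H \<and> card (pverts H) = card (pverts G) \<longrightarrow>
        card (uedges H) \<le> card (uedges G))"

end

theory Submission
  imports Defs
begin

text \<open>
  The graph is the complete multipartite graph with \<open>t = n / 3\<close> parts of size three, \<open>t\<close> odd.  Its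
  edges are oriented along a regular tournament on the parts.  If the second circuit is the first
  one rotated by one place inside every part, the two circuits avoid each other everywhere, but they
  do not start at a common vertex \<open>u\<close>.  This is repaired by a switch: among the second circuit's
  arcs, those assigned to the two arcs from \<open>u\<close> and from another vertex \<open>u'\<close> of its part to a
  vertex \<open>x\<close> exchange their tails, and similarly with heads for a vertex \<open>y\<close> of a preceding part.
  A pair of circuits is then a single closed trail in a digraph whose vertices are pairs of
  positions; that digraph is connected and balanced, so it has an Euler circuit, and it enters the
  pair \<open>(u, u)\<close> only once.

  Conversely, a vertex of degree \<open>n - 1\<close> cannot be avoided by a circuit starting elsewhere, and since
  degrees are even they are at most \<open>n - 3\<close>.
\<close>

section \<open>Closed trails\<close>

text \<open>Each interior visit to \<open>v\<close> uses two incident arcs, one in and one out, so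
  only the two ends of the walk affect the parity. A loop would be counted once instead of twice,
  hence its exclusion.\<close>

lemma length_filter_vwalk_arcs_parity:
  assumes "p \<noteq> []" and "\<forall>e \<in> set (vwalk_arcs p). fst e \<noteq> snd e"
  shows "odd (length (filter (\<lambda>e. v \<in> uedge e) (vwalk_arcs p))) \<longleftrightarrow> (hd p = v) \<noteq> (last p = v)"
  using assms
proof (induction p rule: vwalk_arcs.induct)
  case (3 x y xs)
  then show ?case by (auto simp: uedge_def)
qed auto

lemma vwalk_arcs_map:
  "vwalk_arcs (map f p) = map (map_prod f f) (vwalk_arcs p)"
  by (induction p rule: vwalk_arcs.induct) auto

lemma vwalk_arcs_nth:
  "Suc i < length p \<Longrightarrow> vwalk_arcs p ! i = (p ! i, p ! Suc i)"
proof (induction p arbitrary: i rule: vwalk_arcs.induct)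
  case (3 x y xs)
  then show ?case by (cases i) auto
qed auto

lemma vwalk_arcs_pawalk_verts:
  "pcas u c v \<Longrightarrow> vwalk_arcs (pawalk_verts u c) = c"
proof (induction c arbitrary: u)
  case (Cons e c)
  then show ?case by (cases c) auto
qed auto

lemma pawalk_verts_neq_Nil: "pawalk_verts u c \<noteq> []"
  by (cases c) auto

lemma hd_pawalk_verts: "pcas u c v \<Longrightarrow> hd (pawalk_verts u c) = u"
  by (cases c) auto

lemma last_pawalk_verts: "pcas u c v \<Longrightarrow> last (pawalk_verts u c) = v"
  by (induction c arbitrary: u) (auto simp: pawalk_verts_neq_Nil)

lemma length_eulerian_circuit:
  assumes "eulerian_circuit G u p"
  shows "length p = Suc (card (uedges G))"
proof -
  have "p \<noteq> []" using assms by (auto simp: eulerian_circuit_def vwalk_def)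
  moreover have "length (vwalk_arcs p) = card (uedges G)"
    using assms distinct_card[of "map uedge (vwalk_arcs p)"] by (simp add: eulerian_circuit_def)
  moreover have "length (vwalk_arcs p) = length p - 1"
    using vwalk_length_simp[of p] unfolding vwalk_length_def .
  ultimately show ?thesis by (cases p) auto
qed

text \<open>It suffices to reach one hub \<open>h\<close>: symmetry of \<open>symcl\<close> reverses
  these walks, and well-formedness keeps them inside \<open>pverts G\<close>, as
  \<open>rtrancl_on\<close> demands.\<close>

lemma connected_with_projI:
  assumes "pair_wf_digraph G" and "h \<in> pverts G"
    and "\<And>v. v \<in> pverts G \<Longrightarrow> (v, h) \<in> (symcl (parcs G))\<^sup>*"
  shows "connected (with_proj G)"
proof -
  interpret pair_wf_digraph G by fact
  have *: "(v, w) \<in> rtrancl_on (pverts G) (symcl (parcs G))"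
    if "(v, w) \<in> (symcl (parcs G))\<^sup>*" "v \<in> pverts G" for v w
    using that
  proof (induction rule: rtrancl_induct)
    case (step y z)
    then have "(v, y) \<in> rtrancl_on (pverts G) (symcl (parcs G))" by simp
    moreover have "z \<in> pverts G"
      using step(2) by (auto simp: symcl_def dest: in_arcsD1 in_arcsD2)
    ultimately show ?case using step(2) by (meson rtrancl_on_into_rtrancl_on)
  qed (simp add: rtrancl_on.rtrancl_on_refl)
  have "sym (symcl (parcs G))" by (auto simp: sym_def symcl_def)
  then have s: "sym ((symcl (parcs G))\<^sup>*)" by (rule sym_rtrancl)
  have "(v, w) \<in> (symcl (parcs G))\<^sup>*" if "v \<in> pverts G" "w \<in> pverts G" for v w
    using assms(3)[OF that(1)] symD[OF s assms(3)[OF that(2)]] by simp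
  with * assms(2) show ?thesis by (auto simp: connected_conv)
qed

section \<open>The maximum number of edges\<close>

context pair_graph
begin

lemma parcs_swap: "(v, w) \<in> parcs G \<Longrightarrow> (w, v) \<in> parcs G"
  using pair_sym_arcs by (auto simp: symmetric_def sym_def)

lemma out_degree_conv: "out_degree (with_proj G) v = card {w. (v, w) \<in> parcs G}"
proof -
  have "out_arcs (with_proj G) v = Pair v ` {w. (v, w) \<in> parcs G}"
    by (auto simp: out_arcs_def)
  then show ?thesis by (simp add: out_degree_def card_image inj_on_def)
qed

text \<open>Handshake lemma: every fibre of \<open>uedge\<close> over \<open>uedges G\<close>
  consists of two opposite arcs, which differ because there are no loops.\<close>

lemma double_card_uedges: "2 * card (uedges G) = (\<Sum>v\<in>pverts G. out_degree (with_proj G) v)"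
proof -
  have "card {e \<in> parcs G. uedge e = E} = 2" if "E \<in> uedges G" for E
  proof -
    from that obtain v w where e: "(v, w) \<in> parcs G" "E = {v, w}"
      by (auto simp: uedges_def uedge_def)
    then have "{e \<in> parcs G. uedge e = E} = {(v, w), (w, v)}"
      by (auto simp: uedge_def doubleton_eq_iff intro: parcs_swap)
    moreover have "v \<noteq> w" using pair_no_loops[OF e(1)] by simp
    ultimately show ?thesis by simp
  qed
  then have "card (parcs G) = (\<Sum>E\<in>uedges G. 2)"
    using sum.image_gen[of "parcs G" "\<lambda>_. 1::nat" uedge] pair_finite_arcs
    by (simp add: uedges_def)
  moreover have "card (parcs G) = (\<Sum>v\<in>pverts G. out_degree (with_proj G) v)"
  proof -
    have "parcs G = (SIGMA v:pverts G. {w. (v, w) \<in> parcs G})"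
      by (auto dest: in_arcsD1)
    moreover have "finite {w. (v, w) \<in> parcs G}" for v
      by (rule finite_subset[OF _ pair_finite_verts]) (auto dest: in_arcsD2)
    ultimately show ?thesis
      using card_SigmaI[of "pverts G" "\<lambda>v. {w. (v, w) \<in> parcs G}"] pair_finite_verts
      by (simp add: out_degree_conv)
  qed
  ultimately show ?thesis by simp
qed

text \<open>The edges at \<open>v\<close> are exactly the steps of the circuit incident to
  \<open>v\<close>; the circuit is closed, so their number is even by the parity lemma.\<close>

lemma even_out_degree:
  assumes "eulerian_circuit G u p"
  shows "even (out_degree (with_proj G) v)"
proof -
  let ?A = "vwalk_arcs p"
  have p: "p \<noteq> []" "set ?A \<subseteq> parcs G" "hd p = last p"
    and d: "distinct (map uedge ?A)" and s: "set (map uedge ?A) = uedges G"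
    using assms by (auto simp: eulerian_circuit_def vwalk_def)
  have "{E \<in> uedges G. v \<in> E} = (\<lambda>w. {v, w}) ` {w. (v, w) \<in> parcs G}"
  proof (intro subset_antisym subsetI)
    fix E assume "E \<in> {E \<in> uedges G. v \<in> E}"
    then obtain x y where "(x, y) \<in> parcs G" "E = {x, y}" "v = x \<or> v = y"
      by (auto simp: uedges_def uedge_def)
    then show "E \<in> (\<lambda>w. {v, w}) ` {w. (v, w) \<in> parcs G}"
      using parcs_swap by (auto simp: insert_commute)
  qed (force simp: uedges_def uedge_def)
  moreover have "inj_on (\<lambda>w. {v, w}) {w. (v, w) \<in> parcs G}"
    by (auto simp: inj_on_def doubleton_eq_iff)
  ultimately have "out_degree (with_proj G) v = card {E \<in> uedges G. v \<in> E}"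
    by (simp add: out_degree_conv card_image)
  also have "{E \<in> uedges G. v \<in> E} = set (filter (\<lambda>E. v \<in> E) (map uedge ?A))"
    using s by auto
  also have "card \<dots> = length (filter (\<lambda>E. v \<in> E) (map uedge ?A))"
    by (rule distinct_card) (use d in auto)
  also have "\<dots> = length (filter (\<lambda>e. v \<in> uedge e) ?A)"
    by (simp add: filter_map comp_def)
  finally show ?thesis
    using length_filter_vwalk_arcs_parity[of p v] p pair_no_loops by (metis subsetD)
qed

text \<open>If \<open>v\<close> were adjacent to all other vertices, the first circuit would
  traverse the edge from \<open>v\<close> to \<open>u\<close> and so visit \<open>v\<close>; at that
  moment no vertex would be left for the second circuit.\<close>

lemma avoiding_circuits_not_dominating:
  assumes "avoiding_circuits G u p q" and "v \<noteq> u" and "v \<in> pverts G"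
  shows "\<exists>w \<in> pverts G. w \<noteq> v \<and> (v, w) \<notin> parcs G"
proof (rule ccontr)
  assume dom: "\<not> ?thesis"
  have p: "eulerian_circuit G u p" and q: "eulerian_circuit G u q"
    using assms by (auto simp: avoiding_circuits_def)
  have hl: "p \<noteq> []" "hd p = u" "last p = u"
    using p by (auto simp: eulerian_circuit_def vwalk_def)
  have "hd p \<in> pverts G"
    using p hl by (auto simp: eulerian_circuit_def vwalk_def)
  then have "(v, u) \<in> parcs G" using dom assms hl by auto
  then have "{v, u} \<in> uedges G" by (force simp: uedges_def uedge_def)
  then have "{v, u} \<in> uedge ` set (vwalk_arcs p)"
    using p by (simp add: eulerian_circuit_def)
  then have "v \<in> set p"
    by (auto simp: uedge_def doubleton_eq_iff elim: in_set_vwalk_arcsE)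
  then obtain i where i: "i < length p" "p ! i = v" by (auto simp: in_set_conv_nth)
  \<comment> \<open>Both ends of the circuit are \<open>u\<close>, which differs from
    \<open>v\<close>, so the visit falls at an interior time, where avoidance is required.\<close>
  have "i \<noteq> 0" using i hl assms(2) by (metis hd_conv_nth)
  moreover have "i \<noteq> card (uedges G)"
    using i hl assms(2) length_eulerian_circuit[OF p] by (auto simp: last_conv_nth)
  ultimately have "1 \<le> i \<and> i < card (uedges G)"
    using i length_eulerian_circuit[OF p] by auto
  then have "v \<noteq> q ! i \<and> (v, q ! i) \<notin> parcs G"
    using assms(1) i by (auto simp: avoiding_circuits_def)
  moreover have "q ! i \<in> pverts G"
    using q i length_eulerian_circuit[OF p] length_eulerian_circuit[OF q]
    by (auto simp: eulerian_circuit_def vwalk_def)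
  ultimately show False using dom by auto
qed

end

text \<open>Circuits from some \<open>u\<close> other than \<open>v\<close> yield a non-neighbour of
  \<open>v\<close>, so the degree is at most \<open>n - 2\<close>; this number is odd and the degree
  is even.\<close>

lemma doubly_eulerian_out_degree_le:
  assumes "doubly_eulerian G" and "odd (card (pverts G))" and "card (pverts G) \<ge> 3"
    and "v \<in> pverts G"
  shows "out_degree (with_proj G) v \<le> card (pverts G) - 3"
proof -
  interpret pair_graph G
    using assms(1) by (simp add: doubly_eulerian_def eulerian_def)
  obtain u where u: "u \<in> pverts G" "u \<noteq> v"
  proof -
    have "\<not> pverts G \<subseteq> {v}"
      using assms(3) card_mono[of "{v}" "pverts G"] by auto
    then show ?thesis using that by auto
  qed
  then obtain p q where a: "avoiding_circuits G u p q"
    using assms(1) by (auto simp: doubly_eulerian_def)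
  from avoiding_circuits_not_dominating[OF a] u assms(4)
  obtain w where w: "w \<in> pverts G" "w \<noteq> v" "(v, w) \<notin> parcs G" by metis
  have "{x. (v, x) \<in> parcs G} \<subseteq> pverts G - {v, w}"
    using w pair_no_loops[of "(v, v)"] by (auto dest: in_arcsD2)
  then have "card {x. (v, x) \<in> parcs G} \<le> card (pverts G - {v, w})"
    by (rule card_mono[rotated]) (use pair_finite_verts in auto)
  also have "\<dots> = card (pverts G) - 2"
    using w assms(4) by (subst card_Diff_subset) auto
  finally have "out_degree (with_proj G) v \<le> card (pverts G) - 2"
    by (simp add: out_degree_conv)
  moreover have "even (out_degree (with_proj G) v)"
    using a even_out_degree by (auto simp: avoiding_circuits_def)
  moreover have "odd (card (pverts G) - 2)" using assms by auto
  ultimately have "out_degree (with_proj G) v \<noteq> card (pverts G) - 2" by metis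
  then show ?thesis using \<open>_ \<le> card (pverts G) - 2\<close> by linarith
qed

lemma edge_maximal_regular:
  assumes "doubly_eulerian G" and "odd (card (pverts G))" and "card (pverts G) \<ge> 3"
    and reg: "\<And>v. v \<in> pverts G \<Longrightarrow> out_degree (with_proj G) v = card (pverts G) - 3"
  shows "edge_maximal G"
proof -
  have "card (uedges H) \<le> card (uedges G)"
    if "doubly_eulerian H" "card (pverts H) = card (pverts G)" for H
  proof -
    have "pair_graph G" "pair_graph H"
      using that assms by (auto simp: doubly_eulerian_def eulerian_def)
    moreover have "(\<Sum>v\<in>pverts H. out_degree (with_proj H) v) \<le> (\<Sum>v\<in>pverts H. card (pverts H) - 3)"
      using that assms by (intro sum_mono doubly_eulerian_out_degree_le) auto
    moreover have "(\<Sum>v\<in>pverts G. out_degree (with_proj G) v) = (\<Sum>v\<in>pverts G. card (pverts G) - 3)"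
      using reg by simp
    ultimately have "2 * card (uedges H) \<le> 2 * card (uedges G)"
      using that by (simp add: pair_graph.double_card_uedges)
    then show ?thesis by simp
  qed
  then show ?thesis using assms by (auto simp: edge_maximal_def)
qed

section \<open>A pair of Eulerian circuits moving in parallel\<close>

definition cyc :: "nat \<times> nat \<Rightarrow> nat \<times> nat" where
  "cyc X = (fst X, (snd X + 1) mod 3)"

text \<open>Vertices are pairs (part, place).  When the first circuit uses the arc \<open>(X, Z)\<close>, the second one
  uses \<open>(out_partner X Z, in_partner X Z)\<close>; the exceptional values are those of the switch, for
  \<open>u = (0, 0)\<close>, \<open>u' = (0, 2)\<close>, \<open>x = (1, 1)\<close>, \<open>y = (2, 1)\<close>.\<close>

definition out_partner :: "nat \<times> nat \<Rightarrow> nat \<times> nat \<Rightarrow> nat \<times> nat" where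
  "out_partner X Z =
    (if X = (0, 0) \<and> Z = (1, 1) then (0, 0) else if X = (0, 2) \<and> Z = (1, 1) then (0, 1) else cyc X)"

definition in_partner :: "nat \<times> nat \<Rightarrow> nat \<times> nat \<Rightarrow> nat \<times> nat" where
  "in_partner X Z =
    (if X = (2, 1) \<and> Z = (0, 0) then (0, 0) else if X = (2, 1) \<and> Z = (0, 2) then (0, 1) else cyc Z)"

text \<open>Oddness of \<open>t\<close> makes a regular tournament on the parts possible; three
  parts are needed to hold \<open>u\<close>, \<open>x\<close> and \<open>y\<close> of the
  switch.\<close>

locale odd_parts =
  fixes t :: nat
  assumes odd_t: "odd t" and t_ge: "3 \<le> t"
begin

text \<open>This is the tournament in which \<open>a\<close> beats \<open>b\<close> if \<open>(b - a) mod t\<close> is odd.\<close>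

definition beats :: "nat \<Rightarrow> nat \<Rightarrow> bool" where
  "beats a b \<longleftrightarrow> a < t \<and> b < t \<and> (a < b \<and> odd (a + b) \<or> b < a \<and> even (a + b))"

definition pts :: "(nat \<times> nat) set" where
  "pts = {..<t} \<times> {..<3}"

definition dir :: "((nat \<times> nat) \<times> (nat \<times> nat)) set" where
  "dir = {(X, Z). X \<in> pts \<and> Z \<in> pts \<and> beats (fst X) (fst Z)}"

definition pair_of :: "(nat \<times> nat) \<times> (nat \<times> nat) \<Rightarrow>
    ((nat \<times> nat) \<times> (nat \<times> nat)) \<times> ((nat \<times> nat) \<times> (nat \<times> nat))" where
  "pair_of e = ((fst e, out_partner (fst e) (snd e)), (snd e, in_partner (fst e) (snd e)))"

text \<open>A vertex is a simultaneous position of both circuits. The two pairs added to the rotated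
  ones are those that the switch creates over \<open>u\<close> and \<open>u'\<close>.\<close>

definition twin :: "((nat \<times> nat) \<times> (nat \<times> nat)) pair_pre_digraph" where
  "twin = \<lparr> pverts = (\<lambda>X. (X, cyc X)) ` pts \<union> {((0, 0), (0, 0)), ((0, 2), (0, 1))},
            parcs = pair_of ` dir \<rparr>"

definition multi :: "nat pair_pre_digraph" where
  "multi = \<lparr> pverts = {..<3 * t},
             parcs = {(v, w). v < 3 * t \<and> w < 3 * t \<and> v mod t \<noteq> w mod t} \<rparr>"

text \<open>The translation by \<open>u\<close> sends \<open>(0, 0)\<close> to \<open>u\<close>, so
  a single pair of circuits from \<open>(0, 0)\<close> serves every start vertex.\<close>

definition embed :: "nat \<Rightarrow> nat \<times> nat \<Rightarrow> nat" where
  "embed u X = (u + fst X + t * snd X) mod (3 * t)"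

section \<open>The regular tournament and the orientation induced by it\<close>

lemma beats_asym: "beats a b \<Longrightarrow> \<not> beats b a"
  by (auto simp: beats_def add.commute)

lemma beats_total: "a < t \<Longrightarrow> b < t \<Longrightarrow> a \<noteq> b \<Longrightarrow> beats a b \<or> beats b a"
  by (auto simp: beats_def add.commute)

lemma card_beats: "card {b. beats b a} = card {b. beats a b}"
proof (cases "even a")
  case True
  \<comment> \<open>For even \<open>a\<close>, the parts beating \<open>a\<close> are the odd ones
    below and the even ones above; those beaten are the even ones below and the odd ones above.
    Decrementing carries the former to the latter.\<close>
  have "bij_betw (\<lambda>b. b - 1) {b. beats b a} {b. beats a b}"
  proof (rule bij_betw_byWitness[where f' = Suc])
    show "(\<lambda>b. b - 1) ` {b. beats b a} \<subseteq> {b. beats a b}"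
    proof clarify
      fix b assume b: "beats b a"
      then have "b \<noteq> 0" using True by (cases "b = 0") (auto simp: beats_def)
      then obtain c where "b = Suc c" by (auto simp: gr0_conv_Suc)
      then show "beats a (b - 1)" using b True by (auto simp: beats_def less_Suc_eq)
    qed
    show "Suc ` {b. beats a b} \<subseteq> {b. beats b a}"
    proof clarify
      fix b assume b: "beats a b"
      then have "Suc b \<noteq> t" "Suc b \<noteq> a" using odd_t True by (auto simp: beats_def)
      then show "beats (Suc b) a" using b True by (auto simp: beats_def)
    qed
    show "\<forall>b\<in>{b. beats b a}. Suc (b - 1) = b"
    proof clarify
      fix b assume "beats b a"
      then have "b \<noteq> 0" using True by (cases "b = 0") (auto simp: beats_def)
      then show "Suc (b - 1) = b" by simp
    qed
  qed simp
  then show ?thesis by (rule bij_betw_same_card)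
next
  case odd: False
  \<comment> \<open>For odd \<open>a\<close> the shift goes upwards. It would send
    \<open>a - 1\<close> to \<open>a\<close> and miss \<open>a + 1\<close>, so \<open>a - 1\<close>
    is sent to \<open>a + 1\<close>.\<close>
  let ?f = "\<lambda>b. if Suc b = a then Suc a else Suc b"
  let ?g = "\<lambda>b. if b = Suc a then a - 1 else b - 1"
  have a: "a \<noteq> 0" using odd by (cases "a = 0") auto
  have "bij_betw ?f {b. beats b a} {b. beats a b}"
  proof (rule bij_betw_byWitness[where f' = ?g])
    show "?f ` {b. beats b a} \<subseteq> {b. beats a b}"
    proof clarify
      fix b assume b: "beats b a"
      then have "Suc a \<noteq> t" "Suc b \<noteq> t" using odd odd_t by (auto simp: beats_def)
      then show "beats a (?f b)" using b odd by (auto simp: beats_def)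
    qed
    show "?g ` {b. beats a b} \<subseteq> {b. beats b a}"
    proof clarify
      fix b assume b: "beats a b"
      then have "b \<noteq> 0" using odd by (cases "b = 0") (auto simp: beats_def)
      then obtain c where "b = Suc c" by (auto simp: gr0_conv_Suc)
      moreover obtain d where "a = Suc d" using a by (auto simp: gr0_conv_Suc)
      ultimately show "beats (?g b) a" using b odd by (auto simp: beats_def less_Suc_eq)
    qed
    show "\<forall>b\<in>{b. beats b a}. ?g (?f b) = b"
      by (auto simp: beats_def)
    show "\<forall>b\<in>{b. beats a b}. ?f (?g b) = b"
    proof clarify
      fix b assume b: "beats a b"
      then have "b \<noteq> 0" using odd by (cases "b = 0") (auto simp: beats_def)
      moreover have "b \<noteq> a" using b by (auto simp: beats_def)
      ultimately show "?f (?g b) = b" using a by auto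
    qed
  qed
  then show ?thesis by (rule bij_betw_same_card)
qed

lemma card_dir: "card {Z. (Z, X) \<in> dir} = card {Z. (X, Z) \<in> dir}"
proof (cases "X \<in> pts")
  case True
  then have "{Z. (Z, X) \<in> dir} = {b. beats b (fst X)} \<times> {..<3}"
    "{Z. (X, Z) \<in> dir} = {b. beats (fst X) b} \<times> {..<3}"
    by (auto simp: dir_def pts_def beats_def)
  then show ?thesis by (simp add: card_beats card_cartesian_product)
qed (simp add: dir_def)

lemma finite_pts: "finite pts"
  by (simp add: pts_def)

lemma finite_dir: "finite dir"
  by (rule finite_subset[of _ "pts \<times> pts"]) (auto simp: dir_def finite_pts)

lemma dir_asym: "(X, Z) \<in> dir \<Longrightarrow> (Z, X) \<notin> dir"
  by (auto simp: dir_def dest: beats_asym)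

lemma cyc_in_pts: "X \<in> pts \<Longrightarrow> cyc X \<in> pts"
  by (auto simp: cyc_def pts_def)

lemma cyc_neq: "cyc X \<noteq> X"
proof -
  have "(snd X + 1) mod 3 \<noteq> snd X" by presburger
  then show ?thesis by (auto simp: cyc_def prod_eq_iff)
qed

lemma special_arcs:
  "((0, 0), (1, 1)) \<in> dir" "((0, 2), (1, 1)) \<in> dir" "((2, 1), (0, 0)) \<in> dir" "((2, 1), (0, 2)) \<in> dir"
  using t_ge by (auto simp: dir_def pts_def beats_def)

section \<open>The digraph of simultaneous positions is Eulerian\<close>

lemma pverts_twin:
  "pverts twin = (\<lambda>X. (X, cyc X)) ` pts \<union> {((0, 0), (0, 0)), ((0, 2), (0, 1))}"
  by (simp add: twin_def)

lemma parcs_twin: "parcs twin = pair_of ` dir"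
  by (simp add: twin_def)

lemma out_partner_in_pverts: "X \<in> pts \<Longrightarrow> (X, out_partner X Z) \<in> pverts twin"
  by (auto simp: pverts_twin out_partner_def)

lemma in_partner_in_pverts: "Z \<in> pts \<Longrightarrow> (Z, in_partner X Z) \<in> pverts twin"
  by (auto simp: pverts_twin in_partner_def)

lemma pair_fin_digraph_twin: "pair_fin_digraph twin"
proof
  show "finite (pverts twin)" by (simp add: pverts_twin finite_pts)
  show "finite (parcs twin)" by (simp add: parcs_twin finite_dir)
qed (auto simp: parcs_twin pair_of_def dir_def out_partner_in_pverts in_partner_in_pverts)

sublocale twin: pair_fin_digraph twin
  by (rule pair_fin_digraph_twin)

lemma in_degree_twin:
  "in_degree (with_proj twin) (X, Y) = card {Z. (Z, X) \<in> dir \<and> in_partner Z X = Y}"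
proof -
  have "in_arcs (with_proj twin) (X, Y) = (\<lambda>Z. pair_of (Z, X)) ` {Z. (Z, X) \<in> dir \<and> in_partner Z X = Y}"
    unfolding in_arcs_def by (auto simp: parcs_twin simp del: split_paired_Ex) (auto simp: pair_of_def)
  then show ?thesis by (simp add: in_degree_def card_image inj_on_def pair_of_def)
qed

lemma out_degree_twin:
  "out_degree (with_proj twin) (X, Y) = card {Z. (X, Z) \<in> dir \<and> out_partner X Z = Y}"
proof -
  have "out_arcs (with_proj twin) (X, Y) = (\<lambda>Z. pair_of (X, Z)) ` {Z. (X, Z) \<in> dir \<and> out_partner X Z = Y}"
    unfolding out_arcs_def by (auto simp: parcs_twin simp del: split_paired_Ex) (auto simp: pair_of_def)
  then show ?thesis by (simp add: out_degree_def card_image inj_on_def pair_of_def)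
qed

text \<open>Balance is inherited from \<open>dir\<close>, except over \<open>u\<close> and
  \<open>u'\<close>. There the switch moves one outgoing arc, to \<open>x\<close>, and one incoming
  arc, from \<open>y\<close>, from the rotated pair to the new pair, so both pairs stay
  balanced.\<close>

lemma twin_balanced:
  assumes "V \<in> pverts twin"
  shows "in_degree (with_proj twin) V = out_degree (with_proj twin) V"
proof -
  obtain X Y where V: "V = (X, Y)" by (cases V)
  have ne: "cyc (0, 0) \<noteq> (0, 0)" "cyc (0, 2) \<noteq> (0, 1)" by (simp_all add: cyc_def)
  have fin: "finite {Z. (Z, X) \<in> dir}" "finite {Z. (X, Z) \<in> dir}" for X
    by (auto intro: finite_subset[OF _ finite_pts] simp: dir_def)
  have "card {Z. (Z, X) \<in> dir \<and> in_partner Z X = Y} = card {Z. (X, Z) \<in> dir \<and> out_partner X Z = Y}"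
  proof (cases "X = (0, 0) \<or> X = (0, 2)")
    case False
    then have "in_partner Z X = cyc X" "out_partner X Z = cyc X" for Z
      by (auto simp: in_partner_def out_partner_def)
    then show ?thesis using card_dir[of X] by (cases "Y = cyc X") auto
  next
    case True
    then have s: "(X, (1, 1)) \<in> dir" "((2, 1), X) \<in> dir" using special_arcs by auto
    show ?thesis
    proof (cases "Y = cyc X")
      case True
      have "{Z. (Z, X) \<in> dir \<and> in_partner Z X = Y} = {Z. (Z, X) \<in> dir} - {(2, 1)}"
        "{Z. (X, Z) \<in> dir \<and> out_partner X Z = Y} = {Z. (X, Z) \<in> dir} - {(1, 1)}"
        using \<open>X = (0, 0) \<or> X = (0, 2)\<close> True ne
        by (auto simp: in_partner_def out_partner_def split: if_splits)
      then show ?thesis using s fin card_dir[of X] by simp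
    next
      case False
      then have "X = (0, 0) \<and> Y = (0, 0) \<or> X = (0, 2) \<and> Y = (0, 1)"
        using assms V \<open>X = (0, 0) \<or> X = (0, 2)\<close> by (auto simp: pverts_twin)
      then have "{Z. (Z, X) \<in> dir \<and> in_partner Z X = Y} = {(2, 1)}"
        "{Z. (X, Z) \<in> dir \<and> out_partner X Z = Y} = {(1, 1)}"
        using s ne by (auto simp: in_partner_def out_partner_def split: if_splits)
      then show ?thesis by simp
    qed
  qed
  then show ?thesis by (simp add: V in_degree_twin out_degree_twin)
qed

lemma twin_connected: "connected (with_proj twin)"
proof (rule connected_with_projI)
  show "pair_wf_digraph twin" by unfold_locales
  let ?E = "symcl (parcs twin)"
  let ?h = "((1, 0), cyc (1, 0))"
  have arc: "((X, out_partner X Z), (Z, in_partner X Z)) \<in> ?E"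
    "((Z, in_partner X Z), (X, out_partner X Z)) \<in> ?E" if "(X, Z) \<in> dir" for X Z
    using that by (auto simp: symcl_def parcs_twin pair_of_def intro!: image_eqI)
  \<comment> \<open>Every switched arc joins part 0 to \<open>x\<close> or \<open>y\<close>, both in
    place 1. As \<open>Z\<close> lies in place 0 and outside part 0, the arc between
    \<open>X\<close> and \<open>Z\<close> is not switched.\<close>
  have adj: "((X, cyc X), (Z, cyc Z)) \<in> ?E"
    if "X \<in> pts" "Z \<in> pts" "fst X \<noteq> fst Z" "snd Z = 0" "fst Z \<noteq> 0" for X Z
  proof (cases "(X, Z) \<in> dir")
    case True
    with arc(1)[OF True] that show ?thesis
      by (cases Z) (auto simp: out_partner_def in_partner_def)
  next
    case False
    then have "(Z, X) \<in> dir" using that beats_total[of "fst X" "fst Z"] by (auto simp: dir_def pts_def)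
    with arc(2)[OF this] that show ?thesis
      by (cases Z) (auto simp: out_partner_def in_partner_def)
  qed
  have h: "(1, 0) \<in> pts" "(2, 0) \<in> pts" "(1, 1) \<in> pts" using t_ge by (auto simp: pts_def)
  then show "?h \<in> pverts twin" by (auto simp: pverts_twin)
  \<comment> \<open>The hub lies in part 1, so vertices of that part make a detour through
    \<open>(2, 0)\<close>.\<close>
  have reg: "((X, cyc X), ?h) \<in> ?E\<^sup>*" if "X \<in> pts" for X
  proof (cases "fst X = 1")
    case True
    then have "((X, cyc X), ((2, 0), cyc (2, 0))) \<in> ?E" using that h by (intro adj) auto
    moreover have "(((2, 0), cyc (2, 0)), ?h) \<in> ?E" using h by (intro adj) auto
    ultimately show ?thesis by (meson r_into_rtrancl rtrancl_trans)
  next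
    case False
    then show ?thesis using that h by (intro r_into_rtrancl adj) auto
  qed
  fix V assume "V \<in> pverts twin"
  then consider X where "X \<in> pts" "V = (X, cyc X)" | "V = ((0, 0), (0, 0))" | "V = ((0, 2), (0, 1))"
    by (auto simp: pverts_twin)
  then show "(V, ?h) \<in> ?E\<^sup>*"
  proof cases
    case 1
    then show ?thesis using reg by simp
  next
    case 2
    with arc(1)[OF special_arcs(1)] have "(V, ((1, 1), cyc (1, 1))) \<in> ?E"
      by (simp add: out_partner_def in_partner_def)
    then show ?thesis using reg h by (meson converse_rtrancl_into_rtrancl)
  next
    case 3
    with arc(1)[OF special_arcs(2)] have "(V, ((1, 1), cyc (1, 1))) \<in> ?E"
      by (simp add: out_partner_def in_partner_def)
    then show ?thesis using reg h by (meson converse_rtrancl_into_rtrancl)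
  qed
qed

text \<open>Euler's theorem gives a closed trail from some vertex; it visits every vertex, so it can
  be rotated to start at the pair \<open>(u, u)\<close>.\<close>

lemma twin_circuit:
  obtains c where "pcas ((0, 0), (0, 0)) c ((0, 0), (0, 0))" "distinct c" "set c = parcs twin"
    "set (pawalk_verts ((0, 0), (0, 0)) c) = pverts twin"
proof -
  let ?O = "((0, 0), (0, 0)) :: (nat \<times> nat) \<times> (nat \<times> nat)"
  obtain u p where e: "twin.euler_trail u p u"
    using twin.closed_euler1[OF twin_connected twin_balanced] by blast
  then have "twin.trail u p u" "?O \<in> set (pawalk_verts u p)"
    by (auto simp: twin.euler_trail_def pverts_twin)
  then obtain c where "twin.trail ?O c ?O" "set c = set p"
    "set (pawalk_verts ?O c) = set (pawalk_verts u p)"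
    by (rule twin.rotate_trailE')
  then show ?thesis
    using e that[of c] by (auto simp: twin.euler_trail_def twin.trail_def twin.awalk_def)
qed

section \<open>The projections of the trail to the two circuits\<close>

lemma fst_pair_of: "(fst (fst (pair_of e)), fst (snd (pair_of e))) = e"
  by (simp add: pair_of_def)

definition partner_arc :: "(nat \<times> nat) \<times> (nat \<times> nat) \<Rightarrow> (nat \<times> nat) \<times> (nat \<times> nat)" where
  "partner_arc e = (snd (fst (pair_of e)), snd (snd (pair_of e)))"

text \<open>This makes the second circuit use every arc once. Rotation permutes \<open>dir\<close>;
  the switch swaps the tails of two partner arcs with a common head, or the heads of two with a
  common tail, which leaves the set of arcs unchanged. Partners keep their parts, and on the finite
  set \<open>dir\<close> injectivity suffices; it is checked for all combinations of places.\<close>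

lemma partner_arc_bij: "bij_betw partner_arc dir dir"
proof -
  have "partner_arc e \<in> dir" if "e \<in> dir" for e
    using that special_arcs t_ge cyc_in_pts
    by (cases e)
      (auto simp: partner_arc_def pair_of_def out_partner_def in_partner_def dir_def pts_def cyc_def)
  moreover have "inj_on partner_arc dir"
  proof (rule inj_onI, goal_cases)
    case (1 e e')
    obtain a x b y a' x' b' y' where [simp]: "e = ((a, x), (b, y))" "e' = ((a', x'), (b', y'))"
      by (metis surj_pair)
    have "x < 3" "y < 3" "x' < 3" "y' < 3" using 1 by (auto simp: dir_def pts_def)
    then have "x = 0 \<or> x = 1 \<or> x = 2" "y = 0 \<or> y = 1 \<or> y = 2"
      "x' = 0 \<or> x' = 1 \<or> x' = 2" "y' = 0 \<or> y' = 1 \<or> y' = 2" by auto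
    with 1(3) show ?case
      by (elim disjE)
        (simp_all add: partner_arc_def pair_of_def out_partner_def in_partner_def cyc_def split: if_splits)
  qed
  ultimately show ?thesis
    by (simp add: bij_betw_def endo_inj_surj finite_dir image_subset_iff)
qed

text \<open>Positions in the same part are not adjacent, so away from \<open>(u, u)\<close> the two
  circuits avoid each other.\<close>

lemma pverts_twin_partners:
  assumes "(X, Y) \<in> pverts twin" "(X, Y) \<noteq> ((0, 0), (0, 0))"
  shows "fst X = fst Y" "X \<noteq> Y" "X \<in> pts" "Y \<in> pts"
  using assms t_ge cyc_neq[of X] cyc_in_pts
  by (auto simp: pverts_twin pts_def cyc_def)

section \<open>The complete multipartite graph with parts of size three\<close>

lemma nat_mod_add_left_cancel:
  fixes a b c m :: nat
  assumes "(c + a) mod m = (c + b) mod m" and "a < m" and "b < m"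
  shows "a = b"
  using assms
proof (induction a b rule: linorder_wlog)
  case (le a b)
  then have "m dvd (c + b) - (c + a)"
    using mod_eq_dvd_iff_nat[of "c + a" "c + b" m] by simp
  with le show ?case by (auto dest: dvd_imp_le)
qed simp

lemma embed_mod: "embed u X mod t = (u + fst X) mod t"
  by (simp add: embed_def mod_mult_self2 mod_mod_cancel)

lemma embed_less: "embed u X < 3 * t"
  using t_ge by (simp add: embed_def)

text \<open>\<open>fst X + t * snd X\<close> is a numeral in base \<open>t\<close> below
  \<open>3 * t\<close>, and translation modulo \<open>3 * t\<close> is injective.\<close>

lemma embed_inj: "inj_on (embed u) pts"
proof (rule inj_onI)
  fix X Y assume X: "X \<in> pts" and Y: "Y \<in> pts" and e: "embed u X = embed u Y"
  have lt: "fst X + t * snd X < 3 * t" if "X \<in> pts" for X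
  proof -
    have "snd X \<le> 2" "fst X < t" using that by (auto simp: pts_def)
    then show ?thesis using mult_le_mono2[of "snd X" 2 t] by linarith
  qed
  have "fst X + t * snd X = fst Y + t * snd Y"
    by (rule nat_mod_add_left_cancel[of u _ "3 * t"])
      (use e lt[OF X] lt[OF Y] in \<open>simp_all add: embed_def add.assoc\<close>)
  moreover have "fst X = (fst X + t * snd X) mod t" "fst Y = (fst Y + t * snd Y) mod t"
    using X Y by (auto simp: pts_def)
  ultimately have "fst X = fst Y" by metis
  with \<open>fst X + _ = _\<close> t_ge show "X = Y" by (simp add: prod_eq_iff)
qed

lemma embed_image: "embed u ` pts = {..<3 * t}"
proof (rule card_subset_eq)
  show "embed u ` pts \<subseteq> {..<3 * t}" using embed_less by auto
  show "card (embed u ` pts) = card {..<3 * t}"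
    using card_image[OF embed_inj[of u]] by (simp add: pts_def card_cartesian_product)
qed simp

lemma embed_mod_eq: "X \<in> pts \<Longrightarrow> Y \<in> pts \<Longrightarrow> embed u X mod t = embed u Y mod t \<longleftrightarrow> fst X = fst Y"
  unfolding embed_mod by (auto simp: pts_def dest: nat_mod_add_left_cancel)

lemma embed_parcs:
  "X \<in> pts \<Longrightarrow> Y \<in> pts \<Longrightarrow> (embed u X, embed u Y) \<in> parcs multi \<longleftrightarrow> fst X \<noteq> fst Y"
  by (simp add: multi_def embed_less embed_mod_eq)

definition embed_arc :: "nat \<Rightarrow> (nat \<times> nat) \<times> (nat \<times> nat) \<Rightarrow> nat set" where
  "embed_arc u e = uedge (map_prod (embed u) (embed u) e)"

text \<open>\<open>dir\<close> orients \<open>multi\<close>: asymmetry of the tournament gives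
  injectivity, totality gives surjectivity.\<close>

lemma embed_arc_bij: "bij_betw (embed_arc u) dir (uedges multi)"
proof (rule bij_betw_imageI)
  show "inj_on (embed_arc u) dir"
  proof (rule inj_onI)
    fix e e' assume d: "e \<in> dir" "e' \<in> dir" and eq: "embed_arc u e = embed_arc u e'"
    obtain X Z X' Z' where [simp]: "e = (X, Z)" "e' = (X', Z')" by (metis surj_pair)
    have "X \<in> pts" "Z \<in> pts" "X' \<in> pts" "Z' \<in> pts" using d by (auto simp: dir_def)
    moreover have "embed u X = embed u X' \<and> embed u Z = embed u Z' \<or>
        embed u X = embed u Z' \<and> embed u Z = embed u X'"
      using eq by (auto simp: embed_arc_def uedge_def doubleton_eq_iff)
    ultimately have "X = X' \<and> Z = Z' \<or> X = Z' \<and> Z = X'"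
      using inj_onD[OF embed_inj[of u]] by metis
    with d dir_asym[of X Z] show "e = e'" by auto
  qed
  show "embed_arc u ` dir = uedges multi"
  proof
    have "embed_arc u (X, Z) \<in> uedges multi" if "(X, Z) \<in> dir" for X Z
    proof -
      have "(embed u X, embed u Z) \<in> parcs multi"
        using that by (subst embed_parcs) (auto simp: dir_def beats_def)
      then show ?thesis by (force simp: uedges_def embed_arc_def)
    qed
    then show "embed_arc u ` dir \<subseteq> uedges multi" by auto
  next
    show "uedges multi \<subseteq> embed_arc u ` dir"
    proof
      fix E assume "E \<in> uedges multi"
      then obtain v w where vw: "(v, w) \<in> parcs multi" "E = {v, w}"
        by (auto simp: uedges_def uedge_def)
      then have "v \<in> embed u ` pts" "w \<in> embed u ` pts" by (auto simp: multi_def embed_image)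
      then obtain X Z where X: "X \<in> pts" "Z \<in> pts" "v = embed u X" "w = embed u Z" by auto
      then have "fst X \<noteq> fst Z" using vw embed_parcs by auto
      then have "(X, Z) \<in> dir \<or> (Z, X) \<in> dir"
        using X beats_total[of "fst X" "fst Z"] by (auto simp: dir_def pts_def)
      moreover have "embed_arc u (X, Z) = E" "embed_arc u (Z, X) = E"
        using X vw by (auto simp: embed_arc_def uedge_def)
      ultimately show "E \<in> embed_arc u ` dir" by blast
    qed
  qed
qed

lemma pair_graph_multi: "pair_graph multi"
proof
  show "finite (pverts multi)" by (simp add: multi_def)
  show "finite (parcs multi)"
    by (rule finite_subset[of _ "{..<3 * t} \<times> {..<3 * t}"]) (auto simp: multi_def)
  show "symmetric (with_proj multi)" by (auto simp: symmetric_def sym_def multi_def)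
qed (auto simp: multi_def)

lemma connected_multi: "connected (with_proj multi)"
proof (rule connected_with_projI)
  show "pair_wf_digraph multi"
    by unfold_locales (auto simp: multi_def)
  show "0 \<in> pverts multi" using t_ge by (simp add: multi_def)
  fix v assume v: "v \<in> pverts multi"
  have E: "(v, w) \<in> symcl (parcs multi)" if "v < 3 * t" "w < 3 * t" "v mod t \<noteq> w mod t" for v w
    using that by (auto simp: multi_def symcl_def)
  show "(v, 0) \<in> (symcl (parcs multi))\<^sup>*"
  proof (cases "v mod t = 0")
    case False
    then show ?thesis using v t_ge by (intro r_into_rtrancl E) (auto simp: multi_def)
  next
    case True
    then have "(v, 1) \<in> symcl (parcs multi)" using v t_ge by (intro E) (auto simp: multi_def)
    moreover have "(1, 0) \<in> symcl (parcs multi)" using t_ge by (intro E) auto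
    ultimately show ?thesis by (meson r_into_rtrancl rtrancl_trans)
  qed
qed

lemma out_degree_multi:
  assumes "v < 3 * t"
  shows "out_degree (with_proj multi) v = 3 * t - 3"
proof -
  interpret multi: pair_graph multi by (rule pair_graph_multi)
  obtain X where X: "X \<in> pts" "v = embed 0 X"
    using assms embed_image[of 0] by (metis imageE lessThan_iff)
  have "{w. (v, w) \<in> parcs multi} = embed 0 ` (({..<t} - {fst X}) \<times> {..<3})"
  proof (intro subset_antisym subsetI)
    fix w assume w: "w \<in> {w. (v, w) \<in> parcs multi}"
    then have "w \<in> embed 0 ` pts" by (auto simp: multi_def embed_image)
    then obtain Z where "Z \<in> pts" "w = embed 0 Z" by auto
    then show "w \<in> embed 0 ` (({..<t} - {fst X}) \<times> {..<3})"
      using w X embed_parcs by (auto simp: pts_def)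
  next
    fix w assume "w \<in> embed 0 ` (({..<t} - {fst X}) \<times> {..<3})"
    then obtain Z where "Z \<in> pts" "fst Z \<noteq> fst X" "w = embed 0 Z" by (force simp: pts_def)
    then show "w \<in> {w. (v, w) \<in> parcs multi}" using X embed_parcs[of X Z 0] by auto
  qed
  moreover have "inj_on (embed 0) (({..<t} - {fst X}) \<times> {..<3})"
    by (rule inj_on_subset[OF embed_inj]) (auto simp: pts_def)
  moreover have "fst X < t" using X by (auto simp: pts_def)
  ultimately show ?thesis
    by (simp add: multi.out_degree_conv card_image card_cartesian_product)
qed

text \<open>Stated for an arbitrary projection \<open>g\<close> so that it covers both circuits,
  \<open>fst\<close> and \<open>snd\<close>. The trail lists each arc of \<open>twin\<close> once,
  and these arcs correspond bijectively through \<open>dir\<close> to the edges of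
  \<open>multi\<close>.\<close>

lemma eulerian_circuit_embed:
  assumes c: "vwalk_arcs P = c" "distinct c" "set c = parcs twin" "set P = pverts twin" "P \<noteq> []"
    and g: "\<And>V. V \<in> pverts twin \<Longrightarrow> g V \<in> pts"
    and bij: "bij_betw (\<lambda>e. map_prod g g (pair_of e)) dir dir"
    and ends: "g (hd P) = (0, 0)" "g (last P) = (0, 0)" and u: "u < 3 * t"
  shows "eulerian_circuit multi u (map (embed u \<circ> g) P)"
proof -
  have "bij_betw (embed_arc u \<circ> (\<lambda>e. map_prod g g (pair_of e))) dir (uedges multi)"
    by (rule bij_betw_trans[OF bij embed_arc_bij])
  moreover have "inj_on pair_of dir" by (metis fst_pair_of inj_onI)
  ultimately have b: "bij_betw (embed_arc u \<circ> map_prod g g) (parcs twin) (uedges multi)"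
    unfolding parcs_twin bij_betw_def by (auto simp: comp_def inj_on_def image_image)
  have m: "map uedge (vwalk_arcs (map (embed u \<circ> g) P)) = map (embed_arc u \<circ> map_prod g g) c"
    by (simp add: vwalk_arcs_map c(1) embed_arc_def map_prod_def case_prod_beta)
  have "(embed u (g V), embed u (g W)) \<in> parcs multi" if "(V, W) \<in> parcs twin" for V W
  proof -
    from that obtain e where e: "e \<in> dir" "(V, W) = pair_of e" by (auto simp: parcs_twin)
    then have "(g V, g W) \<in> dir"
      using bij_betw_apply[OF bij e(1)] by (simp flip: e(2))
    then show ?thesis by (subst embed_parcs) (auto simp: dir_def beats_def)
  qed
  then have "vwalk (map (embed u \<circ> g) P) (with_proj multi)"
    using c by (auto simp: vwalk_def vwalk_arcs_map multi_def embed_less)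
  moreover have "embed u (0, 0) = u" using u by (simp add: embed_def)
  ultimately show ?thesis
    using b c ends unfolding eulerian_circuit_def m
    by (simp add: distinct_map bij_betw_def hd_map last_map)
qed

lemma avoiding_multi:
  assumes "u < 3 * t"
  shows "\<exists>p q. avoiding_circuits multi u p q"
proof -
  let ?O = "((0, 0), (0, 0)) :: (nat \<times> nat) \<times> (nat \<times> nat)"
  obtain c where cas: "pcas ?O c ?O" and c: "distinct c" "set c = parcs twin"
    "set (pawalk_verts ?O c) = pverts twin"
    by (rule twin_circuit)
  define P where "P = pawalk_verts ?O c"
  have P: "vwalk_arcs P = c" "hd P = ?O" "last P = ?O" "P \<noteq> []"
    using cas by (simp_all add: P_def vwalk_arcs_pawalk_verts hd_pawalk_verts last_pawalk_verts
        pawalk_verts_neq_Nil)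
  have pts: "fst V \<in> pts" "snd V \<in> pts" if "V \<in> pverts twin" for V
    using that pverts_twin_partners[of "fst V" "snd V"] t_ge by (cases "V = ?O"; simp add: pts_def)+
  have p: "eulerian_circuit multi u (map (embed u \<circ> fst) P)"
    using P c pts assms fst_pair_of
    by (intro eulerian_circuit_embed) (auto simp: P_def map_prod_def case_prod_beta bij_betw_def inj_on_def)
  have q: "eulerian_circuit multi u (map (embed u \<circ> snd) P)"
    using P c pts assms partner_arc_bij
    by (intro eulerian_circuit_embed) (auto simp: P_def map_prod_def case_prod_beta partner_arc_def[abs_def])
  have len: "length P = Suc (card (uedges multi))"
    using length_eulerian_circuit[OF p] by simp
  have lenc: "length c = card (uedges multi)"
    using len vwalk_length_simp[of P] unfolding vwalk_length_def P(1) by simp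
  \<comment> \<open>The only arc into \<open>(u, u)\<close> is the switched one from
    \<open>y\<close>. The closed trail ends with it, at index \<open>j\<close>; an earlier return at
    position \<open>i\<close> would repeat it at index \<open>i - 1\<close>.\<close>
  have not_O: "P ! i \<noteq> ?O" if i: "1 \<le> i" "i < card (uedges multi)" for i
  proof
    assume O: "P ! i = ?O"
    have into_O: "e = (((2, 1), cyc (2, 1)), ?O)" if "e \<in> parcs twin" "snd e = ?O" for e
      using that by (auto simp: parcs_twin pair_of_def in_partner_def out_partner_def cyc_def split: if_splits)
    have arc: "c ! k = (P ! k, P ! Suc k)" if "k < card (uedges multi)" for k
      using vwalk_arcs_nth[of k P] that len by (simp add: P(1))
    define j where "j = card (uedges multi) - 1"
    have j: "j < card (uedges multi)" "Suc j = card (uedges multi)" "i - 1 < j" "Suc (i - 1) = i"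
      using i by (auto simp: j_def)
    have "P ! Suc j = ?O" using P len j by (simp add: last_conv_nth)
    then have "c ! j = (((2, 1), cyc (2, 1)), ?O)"
      using arc[of j] j lenc c(2) nth_mem[of j c] by (intro into_O) auto
    moreover have "c ! (i - 1) = (((2, 1), cyc (2, 1)), ?O)"
      using arc[of "i - 1"] O j lenc c(2) nth_mem[of "i - 1" c] by (intro into_O) auto
    ultimately show False
      using nth_eq_iff_index_eq[OF c(1), of j "i - 1"] j lenc by auto
  qed
  have vert: "P ! i \<in> pverts twin" if "i < card (uedges multi)" for i
    using that len c(3) nth_mem[of i P] unfolding P_def by simp
  have parallel: "fst (fst (P ! i)) = fst (snd (P ! i))" "fst (P ! i) \<noteq> snd (P ! i)"
    if "1 \<le> i" "i < card (uedges multi)" for i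
    using pverts_twin_partners(1,2)[of "fst (P ! i)" "snd (P ! i)"] vert[OF that(2)] not_O[OF that]
    by (metis prod.collapse)+
  have "avoiding_circuits multi u (map (embed u \<circ> fst) P) (map (embed u \<circ> snd) P)"
    unfolding avoiding_circuits_def
  proof (intro conjI allI impI; (elim conjE)?)
    fix i assume i: "1 \<le> i" "i < card (uedges multi)"
    have "fst (P ! i) \<in> pts" "snd (P ! i) \<in> pts" using pts vert[OF i(2)] by auto
    then have "embed u (fst (P ! i)) \<noteq> embed u (snd (P ! i))"
      "(embed u (fst (P ! i)), embed u (snd (P ! i))) \<notin> parcs multi"
      using parallel[OF i] inj_onD[OF embed_inj[of u]] by (metis, simp add: embed_parcs)
    then show "map (embed u \<circ> fst) P ! i \<noteq> map (embed u \<circ> snd) P ! i"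
      "(map (embed u \<circ> fst) P ! i, map (embed u \<circ> snd) P ! i) \<notin> parcs multi"
      using i len by auto
  qed (fact p q)+
  then show ?thesis by blast
qed

lemma doubly_eulerian_multi: "doubly_eulerian multi"
proof -
  have "0 < 3 * t" using t_ge by simp
  then have "\<exists>u p. eulerian_circuit multi u p"
    using avoiding_multi by (meson avoiding_circuits_def)
  then show ?thesis
    using pair_graph_multi connected_multi avoiding_multi
    by (auto simp: doubly_eulerian_def eulerian_def multi_def)
qed

end

theorem theorem1:
  fixes n :: nat
  assumes "n mod 6 = 3" and "n \<ge> 9"
  shows "\<exists>G :: nat pair_pre_digraph.
           card (pverts G) = n \<and> edge_maximal G \<and>
           (\<forall>v \<in> pverts G. out_degree (with_proj G) v = n - 3)"
proof -
  define t where "t = n div 3"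
  \<comment> \<open>From \<open>n = 6 * k + 3\<close> one gets \<open>t = 2 * k + 1\<close>, and
    \<open>n \<ge> 9\<close> gives \<open>k \<ge> 1\<close>.\<close>
  have n: "n = 3 * t" "odd t" "3 \<le> t" using assms unfolding t_def by presburger+
  interpret odd_parts t by unfold_locales (use n in auto)
  have card: "card (pverts multi) = n" by (simp add: multi_def n)
  have deg: "out_degree (with_proj multi) v = n - 3" if "v \<in> pverts multi" for v
    using that out_degree_multi by (simp add: n multi_def)
  have "edge_maximal multi"
    using doubly_eulerian_multi n deg card by (intro edge_maximal_regular) auto
  then show ?thesis using card deg by blast
qed

end
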